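(* Let $V_1,V_2$ be complex Banach spaces, and let $C_1\subset V_1$, $C_2\subset V_2$ be proper complex cones (not necessarily linearly convex). Let $T:V_1\to V_2$ be a (complex) linear map, and suppose that $T(C_1\setminus\{0\})\subset C_2\setminus\{0\}$. If the diameter $\Delta=\sup_{x,y\in C_1\setminus\{0\}}\delta_{C_2}(Tx,Ty)$ is finite, then $$ \forall x,y\in C_1\setminus\{0\},\quad \delta_{C_2}(Tx,Ty)\leq \tanh\left(\frac{\Delta}{4}\right)\delta_{C_1}(x,y). $$
   Context: Let $V$ be a complex Banach space. A non-empty subset $C\subset V$ is a complex cone if $\mathbb{C}^*C\subset C$, where $\mathbb{C}^*=\mathbb{C}\setminus\{0\}$; it is proper if its closure $\overline{C}$ contains no complex plane (no complex vector subspace of complex dimension 2). No topological assumption is made on cones. For a proper complex cone $C$ and $x,y\in C\setminus\{0\}$, let $E_C(x,y)=\{z\in\mathbb{C}: zx-y\notin C\}$. If $x,y$ are colinear, $\delta_C(x,y)=0$. If $x,y$ are linearly independent, $\delta_C(x,y)=\log(b/a)\in[0,\infty]$, where $b=\sup\{|z|:z\in E_C(x,y)\}\in(0,\infty]$ and $a=\inf\{|z|:z\in E_C(x,y)\}\in[0,\infty)$ (with $\log(b/a)=\infty$ if $b=\infty$ or $a=0$; properness guarantees $E_C(x,y)\ne\emptyset$). *)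

theory Defs
  imports "HOL-Analysis.Analysis"
begin

section \<open>Complex Banach spaces\<close>

class scaleC =
  fixes scaleC :: "complex \<Rightarrow> 'a \<Rightarrow> 'a"  (infixr \<open>*\<^sub>C\<close> 75)

text \<open>The norm, metric, topology and real scalar multiplication are those of
  \<^class>\<open>real_normed_vector\<close>; the complex scalar multiplication extends the real one.\<close>

class complex_normed_vector = real_normed_vector + scaleC +
  assumes scaleC_add_right: "a *\<^sub>C (x + y) = a *\<^sub>C x + a *\<^sub>C y"
    and scaleC_add_left: "(a + b) *\<^sub>C x = a *\<^sub>C x + b *\<^sub>C x"
    and scaleC_scaleC: "a *\<^sub>C b *\<^sub>C x = (a * b) *\<^sub>C x"
    and scaleC_one: "1 *\<^sub>C x = x"
    and scaleR_scaleC: "r *\<^sub>R x = complex_of_real r *\<^sub>C x"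
    and norm_scaleC: "norm (a *\<^sub>C x) = cmod a * norm x"

class complex_banach = complex_normed_vector + complete_space

global_interpretation complex_vector:
  vector_space "scaleC :: complex \<Rightarrow> 'a \<Rightarrow> 'a::complex_normed_vector"
  by unfold_locales
    (simp_all add: scaleC_add_right scaleC_add_left scaleC_scaleC scaleC_one)

instantiation complex :: complex_banach
begin

definition scaleC_complex :: "complex \<Rightarrow> complex \<Rightarrow> complex"
  where "scaleC_complex a x = a * x"

instance
  by standard (simp_all add: scaleC_complex_def algebra_simps scaleR_conv_of_real norm_mult)

end


section \<open>Complex cones and the projective gauge\<close>

definition complex_cone :: "'a::complex_normed_vector set \<Rightarrow> bool"
  where "complex_cone C \<longleftrightarrow> C \<noteq> {} \<and> (\<forall>c x. c \<noteq> 0 \<longrightarrow> x \<in> C \<longrightarrow> c *\<^sub>C x \<in> C)"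

text \<open>\<open>complex_vector.dim\<close> is \<open>0\<close> on spaces of infinite dimension, so dimension \<open>2\<close>
  here always means a genuine complex plane.\<close>

definition proper_complex_cone :: "'a::complex_normed_vector set \<Rightarrow> bool"
  where "proper_complex_cone C \<longleftrightarrow> complex_cone C \<and>
    \<not> (\<exists>P. complex_vector.subspace P \<and> complex_vector.dim P = 2 \<and> P \<subseteq> closure C)"

text \<open>Linear dependence of the family \<open>(x, y)\<close> rather than of the set \<open>{x, y}\<close>, which
  would be independent when \<open>x = y \<noteq> 0\<close>.\<close>

definition complex_colinear :: "'a::complex_normed_vector \<Rightarrow> 'a \<Rightarrow> bool"
  where "complex_colinear x y \<longleftrightarrow> (\<exists>a b. (a, b) \<noteq> (0, 0) \<and> a *\<^sub>C x + b *\<^sub>C y = 0)"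

definition cone_E :: "'a::complex_normed_vector set \<Rightarrow> 'a \<Rightarrow> 'a \<Rightarrow> complex set"
  where "cone_E C x y = {z. z *\<^sub>C x - y \<notin> C}"

text \<open>Only meaningful for a proper complex cone \<open>C\<close> and nonzero \<open>x, y \<in> C\<close>;
  then \<open>cone_E C x y\<close> is nonempty when \<open>x, y\<close> are not colinear.\<close>

definition cone_delta :: "'a::complex_normed_vector set \<Rightarrow> 'a \<Rightarrow> 'a \<Rightarrow> ereal"
  where "cone_delta C x y =
    (if complex_colinear x y then 0
     else
       let b = (SUP z\<in>cone_E C x y. ereal (cmod z));
           a = (INF z\<in>cone_E C x y. ereal (cmod z))
       in if b = \<infinity> \<or> a = 0 then \<infinity>
          else ereal (ln (real_of_ereal b / real_of_ereal a)))"

end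

theory Submission imports Defs begin

text \<open>
  The contraction is already visible in the complex plane spanned by \<open>x\<close> and \<open>y\<close>, and there it
  reduces to the classical one-dimensional estimate of Birkhoff.

  Suppose that \<open>x\<close>, \<open>y\<close> have finite gauge \<open>ln (b / a)\<close>, so that \<open>cone_E C\<^sub>1 x y\<close> lies in the closed
  annulus of radii \<open>a\<close>, \<open>b\<close>.  Because \<open>T\<close> maps the cone into the cone, the set
  \<open>cone_E C\<^sub>2 (T x) (T y)\<close> is contained in \<open>cone_E C\<^sub>1 x y\<close>, hence in the same annulus.  Whenever
  \<open>z\<close> and \<open>w\<close> lie outside the annulus, \<open>z x - y\<close> and \<open>w x - y\<close> are in \<open>C\<^sub>1\<close>, so the diameter
  bounds the gauge of their images.  The passage from the pair \<open>(x, y)\<close> to the pair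
  \<open>(z x - y, w x - y)\<close> changes the set \<open>cone_E\<close> by the Moebius map
  \<open>\<zeta> \<mapsto> (\<zeta> - w) / (\<zeta> - z)\<close> (lemma \<open>cone_E_moebius\<close>).  Therefore the diameter bounds the
  modulus of every cross-ratio of two points \<open>z\<close>, \<open>w\<close> off the annulus and two points \<open>\<zeta>\<^sub>1\<close>, \<open>\<zeta>\<^sub>2\<close>
  of \<open>cone_E C\<^sub>2 (T x) (T y)\<close>.

  Now push \<open>w\<close> to the outer circle along the ray through \<open>\<zeta>\<^sub>1\<close>, and \<open>z\<close> to the inner circle along
  the ray through \<open>\<zeta>\<^sub>2\<close>.  By the triangle inequality, this choice bounds the \<^emph>\<open>real\<close> cross-ratio of
  \<open>a\<close>, \<open>b\<close> and the moduli of \<open>\<zeta>\<^sub>1\<close>, \<open>\<zeta>\<^sub>2\<close> by \<open>exp \<Delta>\<close>.  In other words, these moduli have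
  distance at most \<open>\<Delta>\<close> in the Hilbert metric of the interval from \<open>a\<close> to \<open>b\<close>, and Birkhoff's
  estimate (lemma \<open>Birkhoff_interval\<close>) bounds the logarithm of their quotient by
  \<open>tanh (\<Delta> / 4) * ln (b / a)\<close>.  The supremum over \<open>\<zeta>\<^sub>1\<close>, \<open>\<zeta>\<^sub>2\<close> is the claim.
\<close>

section \<open>Birkhoff's estimate on an interval\<close>

text \<open>Both sides vanish at \<open>k = 1\<close>; the difference of the derivatives in \<open>k\<close> is a positive multiple
  of \<open>(q - 1) * q * (k - 1)\<^sup>2\<close>.\<close>

lemma ln_moebius_le:
  fixes k q :: real
  assumes k: "1 \<le> k" and q: "1 \<le> q"
  shows "ln ((1 + k * q) / (k + q)) \<le> (q - 1) / (q + 1) * ln k"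
proof -
  define f where "f t = (q - 1) / (q + 1) * ln t + ln (t + q) - ln (1 + t * q)" for t
  have "f 1 \<le> f k"
  proof (rule DERIV_nonneg_imp_nondecreasing[OF k])
    fix t :: real
    assume t: "1 \<le> t" "t \<le> k"
    define D where "D = (q - 1) / (q + 1) * (1 / t) + 1 / (t + q) - q / (1 + t * q)"
    have pos: "t > 0" "q + 1 > 0" "t + q > 0" "1 + t * q > 0"
      using t q by (auto intro!: add_pos_nonneg mult_nonneg_nonneg)
    have "(f has_real_derivative D) (at t)"
      unfolding f_def D_def using pos
      by (auto intro!: derivative_eq_intros)
    moreover have "D = (q - 1) * q * (t - 1)\<^sup>2 / ((q + 1) * t * (t + q) * (1 + t * q))"
    proof -
      have ne: "t \<noteq> 0" "q + 1 \<noteq> 0" "t + q \<noteq> 0" "1 + t * q \<noteq> 0"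
        using pos by linarith+
      show ?thesis
        unfolding D_def using ne
        by (simp add: divide_simps) (simp add: algebra_simps power2_eq_square)
    qed
    then have "0 \<le> D"
      using pos q by simp
    ultimately show "\<exists>D. (f has_real_derivative D) (at t) \<and> 0 \<le> D"
      by blast
  qed
  moreover have "f 1 = 0"
    by (simp add: f_def add.commute)
  moreover have "ln ((1 + k * q) / (k + q)) = ln (1 + k * q) - ln (k + q)"
  proof -
    have "0 < 1 + k * q" "0 < k + q"
      using k q by (auto intro!: add_pos_nonneg mult_nonneg_nonneg)
    then show ?thesis
      by (simp add: ln_div)
  qed
  ultimately show ?thesis
    by (simp add: f_def)
qed

text \<open>In the coordinates \<open>X = (r - a) / (b - r)\<close> and \<open>Y = (s - a) / (b - s)\<close>, the hypothesis says
  \<open>X \<le> q\<^sup>2 * Y\<close>.  For a given \<open>Y\<close> the quotient \<open>r / s\<close> is largest when \<open>X = q\<^sup>2 * Y\<close>, and then the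
  inequality of the arithmetic and geometric means shows that the symmetric position
  \<open>Y = \<alpha> / (\<beta> * q)\<close> is the extremal one.\<close>

lemma quotient_le_of_cross_ratio_le:
  fixes \<alpha> \<beta> q r s :: real
  assumes \<alpha>: "0 < \<alpha>" "\<alpha> \<le> \<beta>" and q: "1 \<le> q"
    and r: "\<alpha>\<^sup>2 < r" "r < \<beta>\<^sup>2" and s: "\<alpha>\<^sup>2 < s" "s < \<beta>\<^sup>2"
    and cross: "(r - \<alpha>\<^sup>2) * (\<beta>\<^sup>2 - s) \<le> q\<^sup>2 * ((\<beta>\<^sup>2 - r) * (s - \<alpha>\<^sup>2))"
  shows "r / s \<le> ((\<alpha> + \<beta> * q) / (\<beta> + \<alpha> * q))\<^sup>2"
proof -
  define Y where "Y = (s - \<alpha>\<^sup>2) / (\<beta>\<^sup>2 - s)"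
  have Y: "Y > 0"
    using s by (simp add: Y_def)
  have s_eq: "s * (1 + Y) = \<alpha>\<^sup>2 + \<beta>\<^sup>2 * Y"
    using s by (simp add: Y_def field_simps)
  have s0: "s > 0" using s zero_le_power2[of \<alpha>] by linarith
  have "r - \<alpha>\<^sup>2 \<le> q\<^sup>2 * ((\<beta>\<^sup>2 - r) * Y)"
    using cross s by (simp add: Y_def field_simps)
  then have r_le: "r * (1 + q\<^sup>2 * Y) \<le> \<alpha>\<^sup>2 + \<beta>\<^sup>2 * (q\<^sup>2 * Y)"
    by (simp add: algebra_simps)
  have P: "1 + Y > 0" "1 + q\<^sup>2 * Y > 0" "\<alpha>\<^sup>2 + \<beta>\<^sup>2 * Y > 0"
    using Y \<alpha> by (auto intro!: add_pos_nonneg mult_nonneg_nonneg)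
  have W: "\<beta> + \<alpha> * q > 0"
    using \<alpha> q by (intro add_pos_nonneg mult_nonneg_nonneg) auto
  have "r / s \<le> ((\<alpha>\<^sup>2 + \<beta>\<^sup>2 * (q\<^sup>2 * Y)) / (1 + q\<^sup>2 * Y)) / ((\<alpha>\<^sup>2 + \<beta>\<^sup>2 * Y) / (1 + Y))"
  proof -
    have "r \<le> (\<alpha>\<^sup>2 + \<beta>\<^sup>2 * (q\<^sup>2 * Y)) / (1 + q\<^sup>2 * Y)"
      using r_le P by (simp add: pos_le_divide_eq)
    moreover have "s = (\<alpha>\<^sup>2 + \<beta>\<^sup>2 * Y) / (1 + Y)"
      using s_eq P by (simp add: eq_divide_eq)
    ultimately show ?thesis
      using s0 by (metis divide_right_mono less_imp_le)
  qed
  also have "\<dots> = (\<alpha>\<^sup>2 + \<beta>\<^sup>2 * (q\<^sup>2 * Y)) * (1 + Y) / ((\<alpha>\<^sup>2 + \<beta>\<^sup>2 * Y) * (1 + q\<^sup>2 * Y))"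
    by simp
  also have "\<dots> \<le> (\<alpha> + \<beta> * q)\<^sup>2 / (\<beta> + \<alpha> * q)\<^sup>2"
  proof -
    have "(\<alpha> + \<beta> * q)\<^sup>2 * ((\<alpha>\<^sup>2 + \<beta>\<^sup>2 * Y) * (1 + q\<^sup>2 * Y))
        - (\<alpha>\<^sup>2 + \<beta>\<^sup>2 * (q\<^sup>2 * Y)) * (1 + Y) * (\<beta> + \<alpha> * q)\<^sup>2
        = (\<beta>\<^sup>2 - \<alpha>\<^sup>2) * (q\<^sup>2 - 1) * (\<alpha> - \<beta> * q * Y)\<^sup>2"
      by (simp add: algebra_simps power2_eq_square)
    moreover have "\<alpha>\<^sup>2 \<le> \<beta>\<^sup>2" "1 \<le> q\<^sup>2"
      using \<alpha> q by (auto intro: power_mono)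
    then have "0 \<le> (\<beta>\<^sup>2 - \<alpha>\<^sup>2) * (q\<^sup>2 - 1) * (\<alpha> - \<beta> * q * Y)\<^sup>2"
      by simp
    ultimately have "(\<alpha>\<^sup>2 + \<beta>\<^sup>2 * (q\<^sup>2 * Y)) * (1 + Y) * (\<beta> + \<alpha> * q)\<^sup>2
        \<le> (\<alpha> + \<beta> * q)\<^sup>2 * ((\<alpha>\<^sup>2 + \<beta>\<^sup>2 * Y) * (1 + q\<^sup>2 * Y))"
      by linarith
    then show ?thesis
      using P W by (simp add: frac_le_eq divide_le_eq pos_le_divide_eq mult_ac)
  qed
  finally show ?thesis
    by (simp add: power_divide)
qed

text \<open>The Hilbert metric of the interval from \<open>a\<close> to \<open>b\<close> is compared here with the Hilbert
  metric \<open>\<bar>ln (r / s)\<bar>\<close> of the half-line of positive numbers: a set of Hilbert diameter \<open>\<Delta>\<close> fills at most the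
  proportion \<open>tanh (\<Delta> / 4)\<close> of the logarithmic length of the interval.\<close>

lemma Birkhoff_interval:
  fixes a b r s \<Delta> :: real
  assumes a: "0 < a" and \<Delta>: "0 \<le> \<Delta>"
    and r: "a < r" "r < b" and s: "a < s" "s < b"
    and cross: "(r - a) * (b - s) \<le> exp \<Delta> * ((b - r) * (s - a))"
  shows "ln (r / s) \<le> tanh (\<Delta> / 4) * ln (b / a)"
proof -
  define \<alpha> \<beta> q where "\<alpha> = sqrt a" and "\<beta> = sqrt b" and "q = exp (\<Delta> / 2)"
  have ab: "a = \<alpha>\<^sup>2" "b = \<beta>\<^sup>2" "0 < \<alpha>" "\<alpha> \<le> \<beta>"
    using a r by (auto simp: \<alpha>_def \<beta>_def)
  have q: "1 \<le> q" "exp \<Delta> = q\<^sup>2"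
    using \<Delta> by (auto simp: q_def simp flip: exp_double)
  have quot: "(\<alpha> + \<beta> * q) / (\<beta> + \<alpha> * q) = (1 + \<beta> / \<alpha> * q) / (\<beta> / \<alpha> + q)"
  proof -
    have "\<alpha> + \<beta> * q = \<alpha> * (1 + \<beta> / \<alpha> * q)" "\<beta> + \<alpha> * q = \<alpha> * (\<beta> / \<alpha> + q)"
      using ab by (simp_all add: field_simps)
    then show ?thesis
      using ab by simp
  qed
  have pos: "(\<alpha> + \<beta> * q) / (\<beta> + \<alpha> * q) > 0"
    using ab q by (intro divide_pos_pos add_pos_pos mult_pos_pos) auto
  have "r / s \<le> ((\<alpha> + \<beta> * q) / (\<beta> + \<alpha> * q))\<^sup>2"
    using ab q r s cross by (intro quotient_le_of_cross_ratio_le) auto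
  then have "ln (r / s) \<le> ln (((\<alpha> + \<beta> * q) / (\<beta> + \<alpha> * q))\<^sup>2)"
    using a r s by (intro ln_mono) auto
  also have "\<dots> = 2 * ln ((1 + \<beta> / \<alpha> * q) / (\<beta> / \<alpha> + q))"
    using pos by (simp only: ln_realpow quot of_nat_numeral)
  also have "\<dots> \<le> 2 * ((q - 1) / (q + 1) * ln (\<beta> / \<alpha>))"
    using ab q by (intro mult_left_mono ln_moebius_le) auto
  also have "\<dots> = (q - 1) / (q + 1) * ln (b / a)"
    using ab by (simp add: ln_realpow flip: power_divide)
  also have "(q - 1) / (q + 1) = tanh (\<Delta> / 4)"
  proof -
    have "exp (- 2 * (\<Delta> / 4)) = 1 / q"
      by (simp add: q_def exp_minus inverse_eq_divide)
    then have "tanh (\<Delta> / 4) = (1 - 1 / q) / (1 + 1 / q)"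
      by (simp only: tanh_real_altdef)
    also have "\<dots> = (q - 1) / (q + 1)"
      using q by (simp add: divide_simps)
    finally show ?thesis ..
  qed
  finally show ?thesis .
qed


section \<open>The projective gauge of a complex cone\<close>

text \<open>Finiteness of the gauge forces its infimum and supremum to be positive real numbers, the radii
  of an annulus that contains \<open>cone_E C x y\<close>.\<close>

lemma cone_delta_finite_annulus:
  assumes "\<not> complex_colinear x y" and ne: "cone_E C x y \<noteq> {}"
    and fin: "cone_delta C x y \<noteq> \<infinity>"
  obtains a b :: real where "0 < a" "a \<le> b" "\<And>z. z \<in> cone_E C x y \<Longrightarrow> a \<le> cmod z \<and> cmod z \<le> b"
    and "cone_delta C x y = ereal (ln (b / a))"
proof -
  define B A where "B = (SUP z\<in>cone_E C x y. ereal (cmod z))"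
    and "A = (INF z\<in>cone_E C x y. ereal (cmod z))"
  have delta: "cone_delta C x y
      = (if B = \<infinity> \<or> A = 0 then \<infinity> else ereal (ln (real_of_ereal B / real_of_ereal A)))"
    using assms(1) by (simp add: cone_delta_def B_def A_def Let_def)
  have bounds: "A \<le> ereal (cmod z)" "ereal (cmod z) \<le> B" if "z \<in> cone_E C x y" for z
    using that by (auto simp: A_def B_def intro: INF_lower SUP_upper)
  obtain z0 where z0: "z0 \<in> cone_E C x y"
    using ne by blast
  have "B \<noteq> \<infinity>" "A \<noteq> 0"
    using fin delta by (auto split: if_splits)
  moreover have "0 \<le> A"
    unfolding A_def by (rule INF_greatest) simp
  ultimately obtain a b where a: "A = ereal a" "0 < a" and b: "B = ereal b"
    using bounds[OF z0] by (cases A; cases B) auto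
  show ?thesis
  proof (rule that)
    show "0 < a" by (fact a)
    show "a \<le> cmod z \<and> cmod z \<le> b" if "z \<in> cone_E C x y" for z
      using bounds[OF that] by (simp add: a b)
    from this[OF z0] show "a \<le> b" by linarith
    show "cone_delta C x y = ereal (ln (b / a))"
      using delta a b by simp
  qed
qed

lemma cone_E_quotient_le:
  assumes "\<not> complex_colinear x y" "cone_delta C x y \<le> ereal M"
    and z: "z \<in> cone_E C x y" and w: "w \<in> cone_E C x y"
  shows "cmod z \<le> exp M * cmod w"
proof -
  obtain a b where ab: "0 < a" "a \<le> b" and
    annulus: "\<And>z. z \<in> cone_E C x y \<Longrightarrow> a \<le> cmod z \<and> cmod z \<le> b"
    and "cone_delta C x y = ereal (ln (b / a))"
    using assms by (elim cone_delta_finite_annulus[of x y C, rotated 3]) auto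
  then have "ln (b / a) \<le> M"
    using assms(2) by simp
  moreover have "0 < b / a"
    using ab by simp
  ultimately have "b / a \<le> exp M"
    using exp_le_cancel_iff[of "ln (b / a)" M] by (simp only: exp_ln)
  then have "b \<le> exp M * a"
    using ab by (simp add: divide_le_eq)
  also have "\<dots> \<le> exp M * cmod w"
    using annulus[OF w] by simp
  finally show ?thesis
    using annulus[OF z] by linarith
qed

lemma cone_delta_leI:
  fixes M :: real
  assumes M: "0 \<le> M" and zero: "0 \<notin> cone_E C x y"
    and quot: "\<And>z w. z \<in> cone_E C x y \<Longrightarrow> w \<in> cone_E C x y \<Longrightarrow> cmod z \<le> exp M * cmod w"
  shows "cone_delta C x y \<le> ereal M"
proof (cases "complex_colinear x y \<or> cone_E C x y = {}")
  case True
  (* On an empty set the supremum and infimum are infinite, and ln (0 / 0) = 0. *)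
  then show ?thesis
    using M by (auto simp: cone_delta_def bot_ereal_def top_ereal_def)
next
  case False
  define B A where "B = (SUP z\<in>cone_E C x y. ereal (cmod z))"
    and "A = (INF z\<in>cone_E C x y. ereal (cmod z))"
  obtain z0 where z0: "z0 \<in> cone_E C x y"
    using False by blast
  have z0_pos: "0 < cmod z0"
    using z0 zero by auto
  have B_le: "B \<le> ereal (exp M * cmod w)" if "w \<in> cone_E C x y" for w
    unfolding B_def using quot[OF _ that] by (auto intro: SUP_least)
  have z0_B: "ereal (cmod z0) \<le> B"
    unfolding B_def using z0 by (rule SUP_upper)
  then obtain b where b: "B = ereal b"
    using B_le[OF z0] by (cases B) auto
  have b_pos: "0 < b"
    using z0_B z0_pos unfolding b ereal_less_eq by linarith
  have A_ge: "ereal (b / exp M) \<le> A"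
    unfolding A_def
    by (rule INF_greatest) (use B_le in \<open>auto simp: b divide_le_eq mult.commute\<close>)
  have "A \<le> ereal (cmod z0)"
    unfolding A_def using z0 by (rule INF_lower)
  then obtain a where a: "A = ereal a"
    using A_ge by (cases A) auto
  have a_ge: "b / exp M \<le> a"
    using A_ge by (simp add: a)
  moreover have "0 < b / exp M"
    using b_pos by simp
  ultimately have a_pos: "0 < a"
    by linarith
  have "b / a \<le> exp M"
    using a_ge a_pos by (simp add: divide_le_eq mult.commute)
  then have "ln (b / a) \<le> ln (exp M)"
    using a_pos b_pos by (intro ln_mono) auto
  moreover have "cone_delta C x y = ereal (ln (b / a))"
    using False a b a_pos by (simp add: cone_delta_def Let_def flip: A_def B_def)
  ultimately show ?thesis
    by simp
qed

lemma cone_delta_nonneg: "0 \<le> cone_delta C x y"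
proof (cases "complex_colinear x y \<or> cone_E C x y = {} \<or> cone_delta C x y = \<infinity>")
  case True
  then show ?thesis
    by (auto simp: cone_delta_def bot_ereal_def top_ereal_def)
next
  case False
  then obtain a b where "0 < a" "a \<le> b" "cone_delta C x y = ereal (ln (b / a))"
    using cone_delta_finite_annulus by metis
  then show ?thesis
    by simp
qed

lemma cone_delta_refl: "cone_delta C x x = 0"
proof -
  have "1 *\<^sub>C x + (- 1) *\<^sub>C x = 0"
    by (simp flip: scaleC_add_left)
  then have "complex_colinear x x"
    unfolding complex_colinear_def by (intro exI[of _ 1] exI[of _ "- 1"]) simp
  then show ?thesis
    by (simp add: cone_delta_def)
qed


section \<open>Changing the basis of the plane\<close>

lemma not_colinear_change_basis:
  assumes xy: "\<not> complex_colinear x y" and zw: "z \<noteq> w"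
  shows "\<not> complex_colinear (z *\<^sub>C x - y) (w *\<^sub>C x - y)"
proof
  assume "complex_colinear (z *\<^sub>C x - y) (w *\<^sub>C x - y)"
  then obtain c d where cd: "(c, d) \<noteq> (0, 0)"
    and "c *\<^sub>C (z *\<^sub>C x - y) + d *\<^sub>C (w *\<^sub>C x - y) = 0"
    unfolding complex_colinear_def by blast
  moreover have "c *\<^sub>C (z *\<^sub>C x - y) + d *\<^sub>C (w *\<^sub>C x - y)
      = (c * z + d * w) *\<^sub>C x + (- c - d) *\<^sub>C y"
    by (simp add: complex_vector.scale_right_diff_distrib complex_vector.scale_left_diff_distrib
        scaleC_add_left scaleC_scaleC)
  ultimately have "(c * z + d * w, - c - d) = (0, 0)"
    using xy unfolding complex_colinear_def by metis
  then have "c * z + d * w = 0" "- c - d = 0"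
    by simp_all
  then have "d = - c" "c * (z - w) = 0"
    by (algebra, algebra)
  then show False
    using cd zw by auto
qed

text \<open>The change of basis acts on the parameter by a Moebius map, because
  \<open>\<lambda> (z x - y) - (w x - y)\<close> is a multiple of \<open>\<zeta> x - y\<close> for \<open>\<lambda> = (\<zeta> - w) / (\<zeta> - z)\<close>.\<close>

lemma cone_E_moebius:
  assumes C: "complex_cone C" and \<zeta>: "\<zeta> \<in> cone_E C x y" and "\<zeta> \<noteq> z" "z \<noteq> w"
  shows "(\<zeta> - w) / (\<zeta> - z) \<in> cone_E C (z *\<^sub>C x - y) (w *\<^sub>C x - y)"
proof -
  define l m where "l = (\<zeta> - w) / (\<zeta> - z)" and "m = (z - w) / (\<zeta> - z)"
  have m: "m \<noteq> 0" "l - 1 = m" "l * z - w = m * \<zeta>"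
    using assms by (simp_all add: l_def m_def field_simps)
  have "l *\<^sub>C (z *\<^sub>C x - y) - (w *\<^sub>C x - y) = (l * z - w) *\<^sub>C x - (l - 1) *\<^sub>C y"
    by (simp add: complex_vector.scale_right_diff_distrib complex_vector.scale_left_diff_distrib
        scaleC_scaleC scaleC_one)
  also have "\<dots> = m *\<^sub>C (\<zeta> *\<^sub>C x - y)"
    by (simp add: m complex_vector.scale_right_diff_distrib scaleC_scaleC)
  finally have eq: "l *\<^sub>C (z *\<^sub>C x - y) - (w *\<^sub>C x - y) = m *\<^sub>C (\<zeta> *\<^sub>C x - y)" .
  have "m *\<^sub>C (\<zeta> *\<^sub>C x - y) \<notin> C"
  proof
    assume "m *\<^sub>C (\<zeta> *\<^sub>C x - y) \<in> C"
    then have "inverse m *\<^sub>C m *\<^sub>C (\<zeta> *\<^sub>C x - y) \<in> C"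
      using C m(1) unfolding complex_cone_def by (metis nonzero_imp_inverse_nonzero)
    then show False
      using \<zeta> m by (simp add: scaleC_scaleC scaleC_one cone_E_def)
  qed
  then show ?thesis
    by (simp add: cone_E_def eq flip: l_def)
qed


section \<open>The contraction principle\<close>

text \<open>The geometric core.  The point \<open>w\<close> is taken on the outer circle as close as possible to
  \<open>\<zeta>\<^sub>1\<close>, and \<open>z\<close> on the inner circle as close as possible to \<open>\<zeta>\<^sub>2\<close>; among the points on the two
  circles this makes the two denominators of the cross-ratio equal to their minimal values
  \<open>b - cmod \<zeta>\<^sub>1\<close> and \<open>cmod \<zeta>\<^sub>2 - a\<close>.\<close>

lemma annulus_quotient_le:
  fixes a b \<Delta> :: real and \<zeta>\<^sub>1 \<zeta>\<^sub>2 :: complex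
  assumes a: "0 < a" and \<Delta>: "0 \<le> \<Delta>"
    and 1: "a < cmod \<zeta>\<^sub>1" "cmod \<zeta>\<^sub>1 < b" and 2: "a < cmod \<zeta>\<^sub>2" "cmod \<zeta>\<^sub>2 < b"
    and cross: "\<And>z w. cmod z = a \<Longrightarrow> cmod w = b \<Longrightarrow>
      cmod ((\<zeta>\<^sub>2 - w) / (\<zeta>\<^sub>2 - z)) \<le> exp \<Delta> * cmod ((\<zeta>\<^sub>1 - w) / (\<zeta>\<^sub>1 - z))"
  shows "ln (cmod \<zeta>\<^sub>1 / cmod \<zeta>\<^sub>2) \<le> tanh (\<Delta> / 4) * ln (b / a)"
proof (rule Birkhoff_interval[OF a \<Delta> 1 2])
  define z w where "z = of_real a * sgn \<zeta>\<^sub>2" and "w = of_real b * sgn \<zeta>\<^sub>1"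
  have nz: "\<zeta>\<^sub>1 \<noteq> 0" "\<zeta>\<^sub>2 \<noteq> 0"
    using a 1 2 by auto
  have norms: "cmod z = a" "cmod w = b"
    using a 1 nz by (auto simp: z_def w_def norm_mult norm_sgn)
  have "\<zeta>\<^sub>1 - w = of_real (cmod \<zeta>\<^sub>1 - b) * sgn \<zeta>\<^sub>1"
    using nz by (simp add: w_def sgn_eq field_simps)
  then have 1: "cmod (\<zeta>\<^sub>1 - w) = b - cmod \<zeta>\<^sub>1"
    using 1 nz by (simp add: norm_mult norm_sgn flip: of_real_diff)
  have "\<zeta>\<^sub>2 - z = of_real (cmod \<zeta>\<^sub>2 - a) * sgn \<zeta>\<^sub>2"
    using nz by (simp add: z_def sgn_eq field_simps)
  then have 2: "cmod (\<zeta>\<^sub>2 - z) = cmod \<zeta>\<^sub>2 - a"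
    using 2 nz by (simp add: norm_mult norm_sgn flip: of_real_diff)
  have 3: "cmod \<zeta>\<^sub>1 - a \<le> cmod (\<zeta>\<^sub>1 - z)"
    using norm_triangle_ineq2[of \<zeta>\<^sub>1 z] norms by simp
  have 4: "b - cmod \<zeta>\<^sub>2 \<le> cmod (\<zeta>\<^sub>2 - w)"
    using norm_triangle_ineq2[of w \<zeta>\<^sub>2] norms by (simp add: norm_minus_commute)
  have pos: "0 < cmod \<zeta>\<^sub>1 - a" "0 < b - cmod \<zeta>\<^sub>2" "0 < cmod \<zeta>\<^sub>2 - a"
    using assms by auto
  have "(cmod \<zeta>\<^sub>1 - a) * (b - cmod \<zeta>\<^sub>2) \<le> cmod (\<zeta>\<^sub>1 - z) * cmod (\<zeta>\<^sub>2 - w)"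
    using 3 4 pos by (intro mult_mono) auto
  also have "\<dots> \<le> exp \<Delta> * (cmod (\<zeta>\<^sub>1 - w) * cmod (\<zeta>\<^sub>2 - z))"
  proof -
    have "0 < cmod (\<zeta>\<^sub>1 - z)" "0 < cmod (\<zeta>\<^sub>2 - z)"
      using pos 2 3 by linarith+
    then show ?thesis
      using cross[OF norms] by (simp add: norm_divide field_simps)
  qed
  finally show "(cmod \<zeta>\<^sub>1 - a) * (b - cmod \<zeta>\<^sub>2) \<le> exp \<Delta> * ((b - cmod \<zeta>\<^sub>1) * (cmod \<zeta>\<^sub>2 - a))"
    by (simp only: 1 2)
qed

text \<open>The annulus of the gauge is closed, whereas the points \<open>z\<close>, \<open>w\<close> above must be off it; this
  is why the radii are relaxed by a factor that tends to \<open>1\<close>.\<close>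

lemma closed_annulus_quotient_le:
  fixes a b \<Delta> :: real and \<zeta>\<^sub>1 \<zeta>\<^sub>2 :: complex
  assumes a: "0 < a" and \<Delta>: "0 \<le> \<Delta>"
    and 1: "a \<le> cmod \<zeta>\<^sub>1" "cmod \<zeta>\<^sub>1 \<le> b" and 2: "a \<le> cmod \<zeta>\<^sub>2" "cmod \<zeta>\<^sub>2 \<le> b"
    and cross: "\<And>z w. cmod z < a \<Longrightarrow> b < cmod w \<Longrightarrow>
      cmod ((\<zeta>\<^sub>2 - w) / (\<zeta>\<^sub>2 - z)) \<le> exp \<Delta> * cmod ((\<zeta>\<^sub>1 - w) / (\<zeta>\<^sub>1 - z))"
  shows "ln (cmod \<zeta>\<^sub>1 / cmod \<zeta>\<^sub>2) \<le> tanh (\<Delta> / 4) * ln (b / a)"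
proof (rule field_le_epsilon)
  fix e :: real
  assume e: "0 < e"
  define a' b' where "a' = a * exp (- e / 2)" and "b' = b * exp (e / 2)"
  have b: "0 < b"
    using a 1 by linarith
  have a': "0 < a'" "a' < a"
    using a e by (auto simp: a'_def)
  have b': "b < b'"
    using b e by (simp add: b'_def)
  have "b' / a' = b / a * exp e"
    using a by (simp add: a'_def b'_def exp_minus field_simps flip: exp_add)
  moreover have "0 < b / a"
    using a b by simp
  ultimately have ln_eq: "ln (b' / a') = ln (b / a) + e"
    by (simp only: ln_mult_pos exp_gt_zero ln_exp)
  have "ln (cmod \<zeta>\<^sub>1 / cmod \<zeta>\<^sub>2) \<le> tanh (\<Delta> / 4) * ln (b' / a')"
    using a' b' 1 2 by (intro annulus_quotient_le \<Delta> cross) auto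
  also have "\<dots> = tanh (\<Delta> / 4) * ln (b / a) + tanh (\<Delta> / 4) * e"
    by (simp add: ln_eq distrib_left)
  also have "\<dots> \<le> tanh (\<Delta> / 4) * ln (b / a) + e"
    using e tanh_real_lt_1[of "\<Delta> / 4"] by simp
  finally show "ln (cmod \<zeta>\<^sub>1 / cmod \<zeta>\<^sub>2) \<le> tanh (\<Delta> / 4) * ln (b / a) + e" .
qed

theorem theorem2p3:
  fixes C\<^sub>1 :: "'a::complex_banach set" and C\<^sub>2 :: "'b::complex_banach set"
    and T :: "'a \<Rightarrow> 'b" and \<Delta> :: ereal
  assumes "proper_complex_cone C\<^sub>1" and "proper_complex_cone C\<^sub>2"
    and "Vector_Spaces.linear scaleC scaleC T"
    and "T ` (C\<^sub>1 - {0}) \<subseteq> C\<^sub>2 - {0}"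
    and "\<Delta> = (SUP (x, y) \<in> (C\<^sub>1 - {0}) \<times> (C\<^sub>1 - {0}). cone_delta C\<^sub>2 (T x) (T y))"
    and "\<Delta> < \<infinity>"
  shows "\<forall>x \<in> C\<^sub>1 - {0}. \<forall>y \<in> C\<^sub>1 - {0}.
    cone_delta C\<^sub>2 (T x) (T y) \<le> ereal (tanh (real_of_ereal \<Delta> / 4)) * cone_delta C\<^sub>1 x y"
proof (intro ballI)
  fix x y
  assume x: "x \<in> C\<^sub>1 - {0}" and y: "y \<in> C\<^sub>1 - {0}"
  interpret T: Vector_Spaces.linear "scaleC :: complex \<Rightarrow> 'a \<Rightarrow> 'a" "scaleC :: complex \<Rightarrow> 'b \<Rightarrow> 'b" T
    by fact
  have C2: "complex_cone C\<^sub>2"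
    using assms(2) by (simp add: proper_complex_cone_def)
  have le_\<Delta>: "cone_delta C\<^sub>2 (T u) (T v) \<le> \<Delta>" if "u \<in> C\<^sub>1 - {0}" "v \<in> C\<^sub>1 - {0}" for u v
    using that unfolding assms(5) by (intro SUP_upper2[of "(u, v)"]) auto
  have "0 \<le> \<Delta>"
    using le_\<Delta>[OF x x] by (simp add: cone_delta_refl)
  then obtain d where d: "\<Delta> = ereal d" "0 \<le> d"
    using assms(6) by (cases \<Delta>) auto
  define \<tau> where "\<tau> = tanh (d / 4)"
  have \<tau>: "0 \<le> \<tau>"
    using d by (simp add: \<tau>_def)
  have "cone_delta C\<^sub>2 (T x) (T y) \<le> ereal \<tau> * cone_delta C\<^sub>1 x y"
  proof (cases "complex_colinear (T x) (T y) \<or> cone_E C\<^sub>2 (T x) (T y) = {}")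
    case True
    then have "cone_delta C\<^sub>2 (T x) (T y) = 0"
      by (auto simp: cone_delta_def bot_ereal_def top_ereal_def)
    then show ?thesis
      using \<tau> cone_delta_nonneg[of C\<^sub>1 x y] by simp
  next
    case False
    then have indep2: "\<not> complex_colinear (T x) (T y)" by blast
    have indep1: "\<not> complex_colinear x y"
    proof
      assume "complex_colinear x y"
      then obtain c e where "(c, e) \<noteq> (0, 0)" "c *\<^sub>C x + e *\<^sub>C y = 0"
        unfolding complex_colinear_def by blast
      moreover from this have "c *\<^sub>C T x + e *\<^sub>C T y = 0"
        by (metis T.add T.scale T.zero)
      ultimately show False
        using indep2 unfolding complex_colinear_def by blast
    qed
    have T_comb: "T (z *\<^sub>C x - y) = z *\<^sub>C T x - T y" for z
      by (simp add: T.diff T.scale)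
    have in_C1: "z *\<^sub>C x - y \<in> C\<^sub>1 - {0}" if "z \<notin> cone_E C\<^sub>1 x y" for z
    proof -
      have "(z, - 1 :: complex) \<noteq> (0, 0)"
        by simp
      then have "z *\<^sub>C x + (- 1) *\<^sub>C y \<noteq> 0"
        using indep1 unfolding complex_colinear_def by metis
      then show ?thesis
        using that by (simp add: cone_E_def scaleC_one)
    qed
    have E_sub: "cone_E C\<^sub>2 (T x) (T y) \<subseteq> cone_E C\<^sub>1 x y"
    proof
      fix z
      assume "z \<in> cone_E C\<^sub>2 (T x) (T y)"
      then have "T (z *\<^sub>C x - y) \<notin> C\<^sub>2"
        by (simp add: cone_E_def T_comb)
      then show "z \<in> cone_E C\<^sub>1 x y"
        using in_C1 assms(4) by blast
    qed
    show ?thesis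
    proof (cases "cone_delta C\<^sub>1 x y = \<infinity>")
      case True
      (* In the extended reals 0 * \<infinity> = 0, so diameter zero needs an argument of its own. *)
      show ?thesis
      proof (cases "d = 0")
        case True
        then show ?thesis
          using le_\<Delta>[OF x y] \<open>cone_delta C\<^sub>1 x y = \<infinity>\<close> d
          by (simp add: \<tau>_def zero_ereal_def)
      next
        case False
        then have "0 < \<tau>"
          using d by (simp add: \<tau>_def)
        then show ?thesis
          using True by simp
      qed
    next
      case finite: False
      have "cone_E C\<^sub>1 x y \<noteq> {}"
        using E_sub False by blast
      then obtain a b where ab: "0 < a" "a \<le> b"
        and annulus: "\<And>z. z \<in> cone_E C\<^sub>1 x y \<Longrightarrow> a \<le> cmod z \<and> cmod z \<le> b"
        and delta1: "cone_delta C\<^sub>1 x y = ereal (ln (b / a))"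
        using cone_delta_finite_annulus[OF indep1 _ finite] by metis
      have "cone_delta C\<^sub>2 (T x) (T y) \<le> ereal (\<tau> * ln (b / a))"
      proof (rule cone_delta_leI)
        show "0 \<le> \<tau> * ln (b / a)"
          using \<tau> ab by simp
        show "0 \<notin> cone_E C\<^sub>2 (T x) (T y)"
          using annulus[of 0] E_sub ab by auto
      next
        fix \<zeta>\<^sub>1 \<zeta>\<^sub>2
        assume E: "\<zeta>\<^sub>1 \<in> cone_E C\<^sub>2 (T x) (T y)" "\<zeta>\<^sub>2 \<in> cone_E C\<^sub>2 (T x) (T y)"
        then have bounds: "a \<le> cmod \<zeta>\<^sub>1" "cmod \<zeta>\<^sub>1 \<le> b" "a \<le> cmod \<zeta>\<^sub>2" "cmod \<zeta>\<^sub>2 \<le> b"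
          using E_sub annulus by blast+
        have "ln (cmod \<zeta>\<^sub>1 / cmod \<zeta>\<^sub>2) \<le> \<tau> * ln (b / a)"
          unfolding \<tau>_def
        proof (rule closed_annulus_quotient_le[OF ab(1) d(2) bounds])
          fix z w :: complex
          assume zw: "cmod z < a" "b < cmod w"
          have out: "z \<notin> cone_E C\<^sub>1 x y" "w \<notin> cone_E C\<^sub>1 x y"
            using zw annulus by fastforce+
          have ne: "z \<noteq> w" "\<zeta>\<^sub>1 \<noteq> z" "\<zeta>\<^sub>2 \<noteq> z"
            using zw ab bounds by auto
          show "cmod ((\<zeta>\<^sub>2 - w) / (\<zeta>\<^sub>2 - z)) \<le> exp d * cmod ((\<zeta>\<^sub>1 - w) / (\<zeta>\<^sub>1 - z))"
          proof (rule cone_E_quotient_le)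
            show "\<not> complex_colinear (z *\<^sub>C T x - T y) (w *\<^sub>C T x - T y)"
              using not_colinear_change_basis[OF indep2 ne(1)] .
            show "cone_delta C\<^sub>2 (z *\<^sub>C T x - T y) (w *\<^sub>C T x - T y) \<le> ereal d"
              using le_\<Delta>[OF in_C1 in_C1, OF out] by (simp add: T_comb d)
          qed (use cone_E_moebius[OF C2] E ne in auto)
        qed
        moreover have "0 < cmod \<zeta>\<^sub>1 / cmod \<zeta>\<^sub>2"
          using ab(1) bounds by (intro divide_pos_pos) linarith+
        ultimately have "cmod \<zeta>\<^sub>1 / cmod \<zeta>\<^sub>2 \<le> exp (\<tau> * ln (b / a))"
          by (metis exp_le_cancel_iff exp_ln)
        then show "cmod \<zeta>\<^sub>1 \<le> exp (\<tau> * ln (b / a)) * cmod \<zeta>\<^sub>2"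
          using ab bounds by (simp add: divide_le_eq split: if_splits)
      qed
      then show ?thesis
        by (simp add: delta1)
    qed
  qed
  then show "cone_delta C\<^sub>2 (T x) (T y)
      \<le> ereal (tanh (real_of_ereal \<Delta> / 4)) * cone_delta C\<^sub>1 x y"
    by (simp add: \<tau>_def d)
qed

end
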